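(* Let $(L,\leq,0,1)$ be a bounded lattice and $e\in L\setminus\{0,1\}$. Let $T_e$ be a $t$-norm on $[0,e]$ and let $U_t: L\times L\to L$ be defined by $$ U_t(x,y)=\begin{cases} T_e(x,y), & (x,y)\in [0,e]^2,\\ x\vee y, & (x,y)\in ([0,e]\times (e,1])\cup((e,1]\times[0,e])\cup(I_e\times I_e),\\ y, & (x,y)\in [0,e]\times I_e,\\ x, & (x,y)\in I_e\times [0,e],\\ 1, & \text{otherwise.} \end{cases} $$ Then the following statements are equivalent: (i) $U_t$ is a uninorm on $L$ with the neutral element $e$; (ii) either $I_e=\emptyset$, or for any $y,z\in I_e$ it holds that $y\vee z\in I_e$ or $y\vee z=1$; (iii) $I_e\vee I_e\subset I_e\cup\{1\}$; (iv) $\vee$ is a $t$-conorm on $I_e\cup\{0,1\}$.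
   Context: $(L,\leq,0,1)$ is a lattice with bottom element $0$ and top element $1$; $\wedge,\vee$ are infimum and supremum; $x<y$ means $x\leq y$ and $x\neq y$. For $a\leq b$, $[a,b]=\{x\in L: a\leq x\leq b\}$, and $[a,b)$, $(a,b]$, $(a,b)$ are defined similarly (with strict inequality $<$ at the open end). Elements $x,y$ are incomparable, written $x\| y$, if $x\nleq y$ and $y\nleq x$; $I_e=\{x\in L: x\| e\}$. $I_e\vee I_e=\{y\vee z: y,z\in I_e\}$. The symbol $\subset$ allows equality. A uninorm on $L$ is a binary operation $U:L^2\to L$ that is commutative, associative, increasing (i.e. order-preserving) in each variable, and has a neutral element $e\in L$, i.e. $U(e,x)=x$ for all $x\in L$. A $t$-norm (resp. $t$-conorm) is a commutative, associative operation, increasing in each variable, whose neutral element is the top (resp. bottom) element. Thus a $t$-norm on $[0,e]$ is such an operation $[0,e]^2\to[0,e]$ with neutral element $e$. That $\vee$ is a $t$-conorm on $I_e\cup\{0,1\}$ means that the restriction of $\vee$ to $(I_e\cup\{0,1\})^2$ takes values in $I_e\cup\{0,1\}$ and is commutative, associative, increasing in each variable (for the induced order) with neutral element $0$. *)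

theory Defs
  imports Main
begin

text \<open>
  Operations on a subset \<open>A\<close> of the ambient order are total functions whose values
  outside \<open>A \<times> A\<close> are irrelevant; closedness of \<open>A\<close> is part of the definition.
\<close>

definition uninorm_on :: "'a::order set \<Rightarrow> 'a \<Rightarrow> ('a \<Rightarrow> 'a \<Rightarrow> 'a) \<Rightarrow> bool" where
  "uninorm_on A e F \<longleftrightarrow>
     (\<forall>x\<in>A. \<forall>y\<in>A. F x y \<in> A) \<and>
     (\<forall>x\<in>A. \<forall>y\<in>A. F x y = F y x) \<and>
     (\<forall>x\<in>A. \<forall>y\<in>A. \<forall>z\<in>A. F (F x y) z = F x (F y z)) \<and>
     (\<forall>x\<in>A. \<forall>y\<in>A. \<forall>z\<in>A. x \<le> y \<longrightarrow> F x z \<le> F y z \<and> F z x \<le> F z y) \<and>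
     e \<in> A \<and> (\<forall>x\<in>A. F e x = x)"

definition tnorm_on :: "'a::order set \<Rightarrow> ('a \<Rightarrow> 'a \<Rightarrow> 'a) \<Rightarrow> bool" where
  "tnorm_on A F \<longleftrightarrow> (\<exists>t\<in>A. (\<forall>x\<in>A. x \<le> t) \<and> uninorm_on A t F)"

definition tconorm_on :: "'a::order set \<Rightarrow> ('a \<Rightarrow> 'a \<Rightarrow> 'a) \<Rightarrow> bool" where
  "tconorm_on A F \<longleftrightarrow> (\<exists>b\<in>A. (\<forall>x\<in>A. b \<le> x) \<and> uninorm_on A b F)"

definition incomparable_set :: "'a::order \<Rightarrow> 'a set" where
  "incomparable_set e = {x. \<not> x \<le> e \<and> \<not> e \<le> x}"

definition join_set :: "'a::lattice set \<Rightarrow> 'a set \<Rightarrow> 'a set" where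
  "join_set A B = {sup y z | y z. y \<in> A \<and> z \<in> B}"

definition U_t :: "'a::bounded_lattice \<Rightarrow> ('a \<Rightarrow> 'a \<Rightarrow> 'a) \<Rightarrow> 'a \<Rightarrow> 'a \<Rightarrow> 'a" where
  "U_t e T x y =
     (if (x, y) \<in> {bot..e} \<times> {bot..e} then T x y
      else if (x, y) \<in> {bot..e} \<times> {e<..top} \<union> {e<..top} \<times> {bot..e}
                     \<union> incomparable_set e \<times> incomparable_set e then sup x y
      else if (x, y) \<in> {bot..e} \<times> incomparable_set e then y
      else if (x, y) \<in> incomparable_set e \<times> {bot..e} then x
      else top)"

end

theory Submission
  imports Defs
begin

text \<open>
  Elements of \<open>[0, e]\<close> act under \<open>U_t\<close> as identities on the complement of \<open>[0, e]\<close>, and the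
  complement is closed under \<open>U_t\<close>, written \<open>*\<close> below. Hence monotonicity always holds, and associativity can only
  fail for three elements of \<open>I_e\<close>; there it holds if joins of elements of \<open>I_e\<close> stay in
  \<open>I_e \<union> {1}\<close>. Conversely, for \<open>y, z \<in> I_e\<close> with \<open>y \<squnion> z \<notin> I_e\<close>,
  associativity on \<open>y, z, z\<close> gives \<open>1 = (y \<squnion> z) * z = y * (z \<squnion> z) = y \<squnion> z\<close>.
\<close>

text \<open>In the mixed cases with an argument in \<open>(e, top]\<close> the join is absorbed by
  that argument, so they merge with the cases that involve \<open>incomparable_set e\<close>. What
  remains is decided by comparisons with \<open>e\<close> alone, which suits case splitting.\<close>

lemma U_t_alt:
  fixes e :: "'a::bounded_lattice"
  shows "U_t e T x y =
    (if x \<le> e \<and> y \<le> e then T x y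
     else if x \<le> e then y
     else if y \<le> e then x
     else if \<not> e \<le> x \<and> \<not> e \<le> y then sup x y
     else top)"
proof -
  have "sup x y = y" if "x \<le> e" "e < y"
    using that by (simp add: sup_absorb2)
  moreover have "sup x y = x" if "y \<le> e" "e < x"
    using that by (simp add: sup_absorb1)
  ultimately show ?thesis
    by (auto simp: U_t_def incomparable_set_def less_le)
qed

lemma uninorm_on_assoc:
  assumes "uninorm_on A e F" "x \<in> A" "y \<in> A" "z \<in> A"
  shows "F (F x y) z = F x (F y z)"
proof -
  have "\<forall>x\<in>A. \<forall>y\<in>A. \<forall>z\<in>A. F (F x y) z = F x (F y z)"
    using assms(1) unfolding uninorm_on_def by (elim conjE)
  then show ?thesis
    using assms(2-4) by simp
qed

lemma tnorm_on_atMost_iff: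
  fixes e :: "'a::bounded_lattice"
  shows "tnorm_on {bot..e} T \<longleftrightarrow> uninorm_on {bot..e} e T"
proof
  assume "tnorm_on {bot..e} T"
  then obtain t where "t \<in> {bot..e}" "\<forall>x\<in>{bot..e}. x \<le> t" "uninorm_on {bot..e} t T"
    unfolding tnorm_on_def by blast
  moreover from this have "t = e"
    by (simp add: antisym)
  ultimately show "uninorm_on {bot..e} e T"
    by simp
next
  assume "uninorm_on {bot..e} e T"
  then show "tnorm_on {bot..e} T"
    unfolding tnorm_on_def by (intro bexI[of _ e]) auto
qed

lemma tconorm_on_iff_uninorm_on_bot:
  fixes A :: "'a::bounded_lattice set"
  assumes "bot \<in> A"
  shows "tconorm_on A F \<longleftrightarrow> uninorm_on A bot F"
proof -
  have "b = bot" if "\<forall>x\<in>A. b \<le> x" for b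
    using that assms bot_unique by blast
  then show ?thesis
    unfolding tconorm_on_def using assms by (intro iffI bexI[of _ bot]) auto
qed

text \<open>Commutativity, associativity, monotonicity and neutrality of \<open>bot\<close> are
  inherited from the whole lattice; only closedness depends on \<open>A\<close>.\<close>

lemma uninorm_on_sup_iff:
  fixes A :: "'a::bounded_lattice set"
  assumes "bot \<in> A"
  shows "uninorm_on A bot sup \<longleftrightarrow> (\<forall>x\<in>A. \<forall>y\<in>A. sup x y \<in> A)"
proof -
  have "x \<le> y \<Longrightarrow> sup x z \<le> sup y z \<and> sup z x \<le> sup z y" for x y z :: 'a
    by (simp add: sup.coboundedI1 sup.coboundedI2)
  then show ?thesis
    using assms by (simp add: uninorm_on_def sup_aci)
qed

lemma uninorm_on_U_t:
  fixes e :: "'a::bounded_lattice"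
  assumes "e \<noteq> top"
    and T: "uninorm_on {bot..e} e T"
    and joins: "\<And>y z. \<lbrakk>y \<in> incomparable_set e; z \<in> incomparable_set e\<rbrakk>
      \<Longrightarrow> sup y z \<in> incomparable_set e \<or> sup y z = top"
  shows "uninorm_on UNIV e (U_t e T)"
proof -
  have closed: "T x y \<le> e" if "x \<le> e" "y \<le> e" for x y
    using T that by (simp add: uninorm_on_def)
  have comm: "T x y = T y x" if "x \<le> e" "y \<le> e" for x y
    using T that by (simp add: uninorm_on_def)
  have assoc: "T (T x y) z = T x (T y z)" if "x \<le> e" "y \<le> e" "z \<le> e" for x y z
    using uninorm_on_assoc[OF T] that by simp
  have mono: "T x z \<le> T y z" if "x \<le> y" "x \<le> e" "y \<le> e" "z \<le> e" for x y z
    using T that by (simp add: uninorm_on_def)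
  have neutral: "T e x = x" if "x \<le> e" for x
    using T that by (simp add: uninorm_on_def)
  have T_le: "T x z \<le> x" if "x \<le> e" "z \<le> e" for x z
    using mono[of z e x] neutral[of x] comm[of x z] that by simp
  \<comment> \<open>A join \<open>\<ge> e\<close> is not in \<open>incomparable_set e\<close>, so
    only the second alternative of \<open>joins\<close> is left.\<close>
  have joins': "e \<le> sup y z \<Longrightarrow> sup y z = top"
    if "\<not> y \<le> e" "\<not> e \<le> y" "\<not> z \<le> e" "\<not> e \<le> z" for y z
    using joins[of y z] that by (auto simp: incomparable_set_def)
  have U_comm: "U_t e T x y = U_t e T y x" for x y
    by (auto simp: U_t_alt comm sup_commute)
  have U_mono: "U_t e T x z \<le> U_t e T y z" if "x \<le> y" for x y z
  proof -
    have "y \<le> e \<Longrightarrow> x \<le> e" and "e \<le> x \<Longrightarrow> e \<le> y"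
      using that by (auto intro: order_trans)
    \<comment> \<open>This covers \<open>y\<close> outside \<open>[bot, e]\<close> with
      \<open>x\<close> and \<open>z\<close> inside, where the right-hand value is \<open>y\<close>
      itself.\<close>
    moreover have "x \<le> e \<Longrightarrow> z \<le> e \<Longrightarrow> T x z \<le> y"
      using T_le that order_trans by blast
    moreover have "sup x z \<le> sup y z"
      using that by (rule sup_mono) simp
    ultimately show ?thesis
      using that by (auto simp: U_t_alt intro: mono)
  qed
  have U_assoc: "U_t e T (U_t e T x y) z = U_t e T x (U_t e T y z)" for x y z
  proof -
    \<comment> \<open>The value \<open>top\<close> of an inner product thus counts as lying outside
      \<open>[bot, e]\<close> in the outer one.\<close>
    have top: "\<not> top \<le> e"
      using assms(1) by (simp add: top_unique)
    show ?thesis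
    proof (cases "\<not> x \<le> e \<and> \<not> y \<le> e \<and> \<not> z \<le> e")
      case True
      \<comment> \<open>If some argument is \<open>\<ge> e\<close>, both bracketings give
        \<open>top\<close>. Otherwise both equal the triple join, since an inner join that reaches
        \<open>e\<close> is already \<open>top\<close>.\<close>
      have "\<not> sup x y \<le> e" "\<not> sup y z \<le> e"
        using True by auto
      moreover have "sup top z = top" "sup x top = top"
        by (simp_all add: sup_absorb1 sup_absorb2)
      ultimately show ?thesis
        using True joins'[of x y] joins'[of y z] sup_assoc[of x y z]
        by (auto simp: U_t_alt top)
    next
      case False
      \<comment> \<open>An argument in \<open>[bot, e]\<close> drops out of both sides as soon as
        another one lies outside; if all three lie inside, associativity of \<open>T\<close>
        applies.\<close>
      then show ?thesis
        by (auto simp: U_t_alt closed assoc top)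
    qed
  qed
  have U_neutral: "U_t e T e x = x" for x
    by (simp add: U_t_alt neutral)
  have U_mono': "U_t e T z x \<le> U_t e T z y" if "x \<le> y" for x y z
    using U_mono[OF that, of z] by (simp only: U_comm[of z x] U_comm[of z y])
  show ?thesis
    unfolding uninorm_on_def
    by (intro conjI ballI impI)
      (rule UNIV_I U_comm U_assoc U_neutral | erule U_mono U_mono')+
qed

lemma sup_eq_top_if_U_t_assoc:
  fixes e :: "'a::bounded_lattice"
  assumes assoc: "U_t e T (U_t e T y z) z = U_t e T y (U_t e T z z)"
    and "y \<in> incomparable_set e" "z \<in> incomparable_set e"
    and "sup y z \<notin> incomparable_set e"
  shows "sup y z = top"
proof -
  have "e \<le> sup y z" "\<not> sup y z \<le> e"
    using assms(2-4) by (auto simp: incomparable_set_def)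
  then show ?thesis
    using assms(1-3) by (simp add: U_t_alt incomparable_set_def)
qed

theorem theorem6:
  fixes e :: "'a::bounded_lattice"
    and T :: "'a \<Rightarrow> 'a \<Rightarrow> 'a"
  assumes "e \<noteq> bot" and "e \<noteq> top"
    and "tnorm_on {bot..e} T"
  shows "(uninorm_on UNIV e (U_t e T) \<longleftrightarrow>
            incomparable_set e = {} \<or>
            (\<forall>y\<in>incomparable_set e. \<forall>z\<in>incomparable_set e.
               sup y z \<in> incomparable_set e \<or> sup y z = top)) \<and>
         ((incomparable_set e = {} \<or>
            (\<forall>y\<in>incomparable_set e. \<forall>z\<in>incomparable_set e.
               sup y z \<in> incomparable_set e \<or> sup y z = top)) \<longleftrightarrow>
            join_set (incomparable_set e) (incomparable_set e) \<subseteq> incomparable_set e \<union> {top}) \<and>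
         (join_set (incomparable_set e) (incomparable_set e) \<subseteq> incomparable_set e \<union> {top} \<longleftrightarrow>
            tconorm_on (incomparable_set e \<union> {bot, top}) sup)"
proof -
  let ?I = "incomparable_set e"
  have T: "uninorm_on {bot..e} e T"
    using assms(3) by (simp add: tnorm_on_atMost_iff)
  \<comment> \<open>Every statement is compared with this universal condition, which is vacuously
    true when \<open>?I\<close> is empty.\<close>
  have "uninorm_on UNIV e (U_t e T) \<longleftrightarrow> (\<forall>y\<in>?I. \<forall>z\<in>?I. sup y z \<in> ?I \<or> sup y z = top)"
  proof
    assume "uninorm_on UNIV e (U_t e T)"
    then have "U_t e T (U_t e T y z) z = U_t e T y (U_t e T z z)" for y z
      by (rule uninorm_on_assoc) simp_all
    then show "\<forall>y\<in>?I. \<forall>z\<in>?I. sup y z \<in> ?I \<or> sup y z = top"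
      using sup_eq_top_if_U_t_assoc by blast
  next
    assume "\<forall>y\<in>?I. \<forall>z\<in>?I. sup y z \<in> ?I \<or> sup y z = top"
    then show "uninorm_on UNIV e (U_t e T)"
      using uninorm_on_U_t[OF assms(2) T] by blast
  qed
  moreover have "join_set ?I ?I \<subseteq> ?I \<union> {top} \<longleftrightarrow>
      (\<forall>y\<in>?I. \<forall>z\<in>?I. sup y z \<in> ?I \<or> sup y z = top)"
    unfolding join_set_def by blast
  moreover have "tconorm_on (?I \<union> {bot, top}) sup \<longleftrightarrow>
      (\<forall>y\<in>?I. \<forall>z\<in>?I. sup y z \<in> ?I \<or> sup y z = top)"
  proof -
    let ?A = "?I \<union> {bot, top}"
    have "bot \<in> ?A"
      by simp
    then have "tconorm_on ?A sup \<longleftrightarrow> (\<forall>x\<in>?A. \<forall>y\<in>?A. sup x y \<in> ?A)"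
      by (simp only: tconorm_on_iff_uninorm_on_bot uninorm_on_sup_iff)
    also have "\<dots> \<longleftrightarrow> (\<forall>y\<in>?I. \<forall>z\<in>?I. sup y z \<in> ?A)"
      by (simp add: ball_Un sup_absorb1 sup_absorb2)
    also have "\<dots> \<longleftrightarrow> (\<forall>y\<in>?I. \<forall>z\<in>?I. sup y z \<in> ?I \<or> sup y z = top)"
    proof -
      \<comment> \<open>A join equal to \<open>bot\<close> would force \<open>y \<le> e\<close>, so
        closedness of \<open>?A\<close> leaves only \<open>?I\<close> and \<open>top\<close> as
        possible values.\<close>
      have "sup y z \<noteq> bot" if "y \<in> ?I" for y z
        using that by (auto simp: incomparable_set_def)
      then show ?thesis
        by blast
    qed
    finally show ?thesis .
  qed
  ultimately show ?thesis
    by blast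
qed

end
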